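(* Reachability is undecidable for uniform PGTRS without variables and parameters. That is, there is no algorithm which, given a finite unranked alphabet $\Sigma$, an HA language $L\subseteq\mathcal{T}(\Sigma)$ (given by an HA), a finite set of rules $L::\ell\to r$ with $\ell,r$ ground hedges over $\Sigma$ (containing no variables and no automaton states), and two ground terms $t,t'\in\mathcal{T}(\Sigma)$, decides whether $t\to^* t'$ for the associated constrained rewrite relation.
   Context: Hedges and terms: for a finite alphabet $\Sigma$, ground hedges $\mathcal{H}(\Sigma)$ are finite (possibly empty) sequences of ground terms, and ground terms are $\mathcal{T}(\Sigma)=\{a(h): a\in\Sigma, h\in\mathcal{H}(\Sigma)\}$ ($a()$ written $a$); symbols are unranked. A context is a hedge containing one distinguished variable exactly once; $u[h]$ denotes replacing it by $h$. Hedge automata: an HA is $(\Sigma,Q,Q^{\mathsf f},\Delta)$ with finite state set $Q$, final states $Q^{\mathsf f}\subseteq Q$, and transitions $a(L')\to q$ with $a\in\Sigma$, $q\in Q$, $L'\subseteq Q^*$ regular; a ground hedge is accepted if it can be reduced to a final state by repeatedly replacing a subterm $a(q_1\dots q_n)$ with $q$ whenever $a(L')\to q$ is a transition and $q_1\dots q_n\in L'$. An HA language is the set of accepted hedges. PGTRS: a term rewriting system with global constraints is a finite set of constrained rules $L::\ell\to r$, where $L\subseteq\mathcal{T}(\Sigma)$ is an HA language and $\ell\to r$ is a (parametrized) rewrite rule. Its rewrite relation is restricted to ground terms: $t\to t'$ iff there is a rule $L::\ell\to r$ with $t\in L$ and $t\to t'$ by the ordinary rule $\ell\to r$ (for ground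 rules: $t=u[\ell]$ and $t'=u[r]$ for some context $u$). $\to^*$ is the reflexive-transitive closure. A PGTRS is uniform if the constraint language $L$ is the same for all its rules. Reachability asks, given $t,t'$, whether $t\to^* t'$. *)

theory Defs
  imports "HOL-Library.Nat_Bijection"
begin

section \<open>Unranked ground terms, hedges and contexts\<close>

datatype (symbols: 'a) gterm = Fn 'a "'a gterm list"

type_synonym 'a hedge = "'a gterm list"

definition ground_terms :: "'a set \<Rightarrow> 'a gterm set" where
  "ground_terms \<Sigma> = {t. symbols t \<subseteq> \<Sigma>}"

definition ground_hedges :: "'a set \<Rightarrow> 'a hedge set" where
  "ground_hedges \<Sigma> = lists (ground_terms \<Sigma>)"

text \<open>
  Hedges with exactly one occurrence of a distinguished variable: the variable
  is either at the top level of the hedge, between two hedges, or inside the argument hedge of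
  exactly one of its top-level terms.
\<close>

datatype 'a hcontext =
    Hole "'a hedge" "'a hedge"
  | Under "'a hedge" 'a "'a hcontext" "'a hedge"

primrec plug :: "'a hcontext \<Rightarrow> 'a hedge \<Rightarrow> 'a hedge" where
  "plug (Hole h1 h2) h = h1 @ h @ h2"
| "plug (Under h1 a u h2) h = h1 @ [Fn a (plug u h)] @ h2"

section \<open>Hedge automata\<close>

text \<open>
  Regular languages are given by nondeterministic finite automata over \<^typ>\<open>nat\<close>; the states of an
  automaton are the numbers mentioned in it.
\<close>

record nfa =
  nfa_initial :: "nat list"
  nfa_final :: "nat list"
  nfa_trans :: "(nat \<times> nat \<times> nat) list"

inductive nfa_run :: "nfa \<Rightarrow> nat \<Rightarrow> nat list \<Rightarrow> nat \<Rightarrow> bool" for N where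
  "nfa_run N p [] p"
| "(p, x, p') \<in> set (nfa_trans N) \<Longrightarrow> nfa_run N p' w p'' \<Longrightarrow> nfa_run N p (x # w) p''"

definition nfa_lang :: "nfa \<Rightarrow> nat list set" where
  "nfa_lang N = {w. \<exists>p\<in>set (nfa_initial N). \<exists>p'\<in>set (nfa_final N). nfa_run N p w p'}"

text \<open>
  The tuple of alphabet, states, final states and transitions. An element \<open>(a, N, q)\<close> of
  \<open>ha_trans\<close> is the transition with symbol \<open>a\<close>, horizontal language \<open>nfa_lang N\<close> and target \<open>q\<close>.
\<close>

record ha =
  ha_alphabet :: "nat list"
  ha_states :: "nat list"
  ha_final :: "nat list"
  ha_trans :: "(nat \<times> nfa \<times> nat) list"

text \<open>The condition on the labels of \<open>N\<close> makes its language a subset of \<open>Q\<^sup>*\<close>.\<close>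

definition wf_ha :: "ha \<Rightarrow> bool" where
  "wf_ha A \<longleftrightarrow>
     set (ha_final A) \<subseteq> set (ha_states A) \<and>
     (\<forall>(a, N, q)\<in>set (ha_trans A).
        a \<in> set (ha_alphabet A) \<and> q \<in> set (ha_states A) \<and>
        (\<forall>(p, x, p')\<in>set (nfa_trans N). x \<in> set (ha_states A)))"

text \<open>
  Hedges occurring during a run contain alphabet symbols, tagged by \<^const>\<open>Inl\<close>, and states, tagged
  by \<^const>\<open>Inr\<close>, so that symbols and states are kept apart even if they are the same number.
\<close>

definition state_term :: "nat \<Rightarrow> (nat + nat) gterm" where
  "state_term q = Fn (Inr q) []"

definition ha_step :: "ha \<Rightarrow> (nat + nat) hedge \<Rightarrow> (nat + nat) hedge \<Rightarrow> bool" where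
  "ha_step A h h' \<longleftrightarrow>
     (\<exists>u a N q qs. (a, N, q) \<in> set (ha_trans A) \<and> qs \<in> nfa_lang N \<and>
        h = plug u [Fn (Inl a) (map state_term qs)] \<and>
        h' = plug u [state_term q])"

definition ha_lang :: "ha \<Rightarrow> nat hedge set" where
  "ha_lang A =
     {h \<in> ground_hedges (set (ha_alphabet A)).
        \<exists>q\<in>set (ha_final A). (ha_step A)\<^sup>*\<^sup>* (map (map_gterm Inl) h) [state_term q]}"

section \<open>Ground rewriting with global constraints\<close>

text \<open>A triple \<open>(L, l, r)\<close> stands for the constrained ground rule \<open>L :: l \<rightarrow> r\<close>.\<close>

type_synonym 'a crule = "'a hedge set \<times> 'a hedge \<times> 'a hedge"

text \<open>Ground terms are identified with one-element hedges.\<close>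

definition pgtrs_step :: "'a crule set \<Rightarrow> 'a gterm \<Rightarrow> 'a gterm \<Rightarrow> bool" where
  "pgtrs_step R t t' \<longleftrightarrow>
     (\<exists>L l r u. (L, l, r) \<in> R \<and> [t] \<in> L \<and> [t] = plug u l \<and> [t'] = plug u r)"

definition uniform :: "'a crule set \<Rightarrow> bool" where
  "uniform R \<longleftrightarrow> (\<exists>L. \<forall>(L', l, r)\<in>R. L' = L)"

section \<open>The reachability problem\<close>

text \<open>The alphabet of an instance is the alphabet of its constraint automaton.\<close>

record reach_instance =
  constraint :: ha
  rules :: "(nat hedge \<times> nat hedge) list"
  source :: "nat gterm"
  target :: "nat gterm"

definition pgtrs_of :: "reach_instance \<Rightarrow> nat crule set" where
  "pgtrs_of I = {(ha_lang (constraint I), l, r) |l r. (l, r) \<in> set (rules I)}"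

lemma uniform_pgtrs_of: "uniform (pgtrs_of I)"
  by (auto simp: uniform_def pgtrs_of_def)

definition wf_instance :: "reach_instance \<Rightarrow> bool" where
  "wf_instance I \<longleftrightarrow>
     (let \<Sigma> = set (ha_alphabet (constraint I)) in
        wf_ha (constraint I) \<and>
        (\<forall>(l, r)\<in>set (rules I). l \<in> ground_hedges \<Sigma> \<and> r \<in> ground_hedges \<Sigma>) \<and>
        source I \<in> ground_terms \<Sigma> \<and> target I \<in> ground_terms \<Sigma>)"

definition reachable :: "reach_instance \<Rightarrow> bool" where
  "reachable I \<longleftrightarrow> (pgtrs_step (pgtrs_of I))\<^sup>*\<^sup>* (source I) (target I)"

section \<open>Numerical encoding of instances\<close>

definition triple_encode :: "nat \<times> nat \<times> nat \<Rightarrow> nat" where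
  "triple_encode = (\<lambda>(x, y, z). prod_encode (x, prod_encode (y, z)))"

primrec gterm_encode :: "nat gterm \<Rightarrow> nat" where
  "gterm_encode (Fn a ts) = prod_encode (a, list_encode (map gterm_encode ts))"

definition hedge_encode :: "nat hedge \<Rightarrow> nat" where
  "hedge_encode h = list_encode (map gterm_encode h)"

definition nfa_encode :: "nfa \<Rightarrow> nat" where
  "nfa_encode N = triple_encode
     (list_encode (nfa_initial N), list_encode (nfa_final N),
      list_encode (map triple_encode (nfa_trans N)))"

definition ha_encode :: "ha \<Rightarrow> nat" where
  "ha_encode A = prod_encode (list_encode (ha_alphabet A), triple_encode
     (list_encode (ha_states A), list_encode (ha_final A),
      list_encode (map (\<lambda>(a, N, q). triple_encode (a, nfa_encode N, q)) (ha_trans A))))"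

definition instance_encode :: "reach_instance \<Rightarrow> nat" where
  "instance_encode I = prod_encode (ha_encode (constraint I), triple_encode
     (list_encode (map (\<lambda>(l, r). prod_encode (hedge_encode l, hedge_encode r)) (rules I)),
      gterm_encode (source I), gterm_encode (target I)))"

lemma triple_encode_inject [simp]: "triple_encode x = triple_encode y \<longleftrightarrow> x = y"
  by (auto simp: triple_encode_def split: prod.splits)

lemma list_encode_map_inject:
  assumes "list_encode (map f xs) = list_encode (map f ys)" "inj f"
  shows "xs = ys"
  using assms by (simp add: list_encode_eq)

lemma inj_gterm_encode: "inj gterm_encode"
proof (rule injI)
  show "s = t" if "gterm_encode s = gterm_encode t" for s t
    using that
  proof (induction s arbitrary: t)
    case (Fn a ss)
    obtain b ts where t: "t = Fn b ts"
      by (cases t)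
    have "a = b" and eq: "map gterm_encode ss = map gterm_encode ts"
      using Fn.prems t by (simp_all add: list_encode_eq)
    moreover have "ss = ts"
    proof (rule nth_equalityI)
      show "length ss = length ts"
        using eq by (metis length_map)
      show "ss ! i = ts ! i" if "i < length ss" for i
        using that Fn.IH eq by (metis length_map nth_map nth_mem)
    qed
    ultimately show ?case
      using t by simp
  qed
qed

lemma inj_hedge_encode: "inj hedge_encode"
  using inj_gterm_encode by (auto simp: hedge_encode_def list_encode_eq intro: injI)

lemma inj_nfa_encode: "inj nfa_encode"
  by (rule injI) (auto simp: nfa_encode_def list_encode_eq inj_def dest!: list_encode_map_inject)

lemma inj_ha_encode: "inj ha_encode"
proof (rule injI)
  have "inj (\<lambda>(a, N, q). triple_encode (a, nfa_encode N, q))"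
    using inj_nfa_encode by (auto simp: inj_def)
  then show "A = B" if "ha_encode A = ha_encode B" for A B
    using that by (auto simp: ha_encode_def list_encode_eq dest!: list_encode_map_inject)
qed

lemma inj_instance_encode: "inj instance_encode"
proof (rule injI)
  have "inj (\<lambda>(l, r). prod_encode (hedge_encode l, hedge_encode r))"
    using inj_hedge_encode by (auto simp: inj_def)
  then show "I = J" if "instance_encode I = instance_encode J" for I J
    using that
    by (auto simp: instance_encode_def inj_eq[OF inj_ha_encode] inj_eq[OF inj_gterm_encode]
        dest!: list_encode_map_inject)
qed

section \<open>Decidability\<close>

text \<open>
  Partial recursive functions. Arities are left implicit: \<^term>\<open>rec_eval f xs y\<close> says that \<open>f\<close> is
  defined on the argument tuple \<open>xs\<close>, with value \<open>y\<close>. In the case of \<open>RMu f\<close>, all values of \<open>f\<close>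
  below the least zero have to be defined.
\<close>

datatype recf =
    RZero
  | RSucc
  | RProj nat
  | RComp recf "recf list"
  | RPrim recf recf
  | RMu recf

inductive rec_eval :: "recf \<Rightarrow> nat list \<Rightarrow> nat \<Rightarrow> bool" where
  zero: "rec_eval RZero xs 0"
| succ: "rec_eval RSucc [x] (Suc x)"
| proj: "i < length xs \<Longrightarrow> rec_eval (RProj i) xs (xs ! i)"
| comp: "list_all2 (\<lambda>g y. rec_eval g xs y) gs ys \<Longrightarrow> rec_eval f ys z \<Longrightarrow>
    rec_eval (RComp f gs) xs z"
| prim_0: "rec_eval f xs y \<Longrightarrow> rec_eval (RPrim f g) (0 # xs) y"
| prim_Suc: "rec_eval (RPrim f g) (n # xs) y \<Longrightarrow> rec_eval g (n # y # xs) z \<Longrightarrow>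
    rec_eval (RPrim f g) (Suc n # xs) z"
| mu: "rec_eval f (n # xs) 0 \<Longrightarrow> (\<And>m. m < n \<Longrightarrow> \<exists>y. rec_eval f (m # xs) (Suc y)) \<Longrightarrow>
    rec_eval (RMu f) xs n"

inductive_cases rec_evalE:
  "rec_eval RZero xs y" "rec_eval RSucc xs y" "rec_eval (RProj i) xs y"
  "rec_eval (RComp f gs) xs y" "rec_eval (RPrim f g) (0 # xs) y"
  "rec_eval (RPrim f g) (Suc n # xs) y" "rec_eval (RMu f) xs y"

lemma rec_eval_deterministic: "rec_eval f xs y \<Longrightarrow> rec_eval f xs z \<Longrightarrow> y = z"
proof (induction arbitrary: z rule: rec_eval.induct)
  case (zero xs)
  then show ?case by (rule rec_evalE(1)) simp
next
  case (succ x)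
  then show ?case by (rule rec_evalE(2)) simp
next
  case (proj i xs)
  from proj.prems show ?case by (rule rec_evalE(3)) simp
next
  case (comp xs gs ys f y)
  from comp.prems obtain zs where zs: "list_all2 (\<lambda>g. rec_eval g xs) gs zs" "rec_eval f zs z"
    by (rule rec_evalE(4))
  have "ys = zs"
    using comp.IH(1) zs(1) by (auto simp: list_all2_conv_all_nth intro!: nth_equalityI)
  then show ?case
    using comp.IH(2) zs(2) by simp
next
  case (prim_0 f xs y g)
  from prim_0.prems show ?case by (rule rec_evalE(5)) (rule prim_0.IH)
next
  case (prim_Suc f g n xs y w)
  from prim_Suc.prems obtain y' where y': "rec_eval (RPrim f g) (n # xs) y'"
    and w: "rec_eval g (n # y' # xs) z"
    by (rule rec_evalE(6))
  have "y = y'"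
    using y' by (rule prim_Suc.IH(1))
  with w show ?case
    by (intro prim_Suc.IH(2)) simp
next
  case (mu f n xs)
  from mu.prems have z: "rec_eval f (z # xs) 0"
    "\<And>m. m < z \<Longrightarrow> \<exists>y. rec_eval f (m # xs) (Suc y)"
    by (rule rec_evalE(7); blast)+
  have "\<not> n < z"
    using mu.IH(1) z(2) by (metis nat.distinct(1))
  moreover have "\<not> z < n"
    using mu.IH(2) z(1) by (metis nat.distinct(1))
  ultimately show ?case
    by simp
qed

text \<open>
  A decision procedure has to halt with the right answer on the codes of all inputs in \<open>D\<close>; its
  behaviour on other numbers is irrelevant.
\<close>

definition decidable_on :: "('i \<Rightarrow> nat) \<Rightarrow> 'i set \<Rightarrow> ('i \<Rightarrow> bool) \<Rightarrow> bool" where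
  "decidable_on code D P \<longleftrightarrow>
     (\<exists>f. \<forall>x\<in>D. rec_eval f [code x] (if P x then 1 else 0))"

end

theory Submission
  imports Defs "HOL-Library.Countable"
begin

text \<open>
  Rules may have hedges of several terms as sides, so on flat terms they are string rewriting rules,
  and a constraint satisfied by all ground terms suffices. Partial recursive functions are implemented
  by programs on stacks of numbers. A stack is written as a word over the letters \<open>Push\<close> and \<open>Inc\<close>,
  and further letters for programs act on the word to their right. Letters cannot overtake one
  another, so a word denotes the composition of the relations of its letters; the rules only shrink
  this relation, which bounds what can be reached. A decision procedure for reachability is refuted
  by a partial recursive function that halts on the codes of an instance exactly if the procedure
  answers ``unreachable'' on that instance, with these same codes as input word.
\<close>

section \<open>Stack programs\<close>

datatype prog = Push | Pop | Inc | Dec | Dip prog | Seq prog prog | Star prog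

instance prog :: countable
  by countable_datatype

text \<open>\<open>Pop\<close> demands a zero on top and \<open>Dec\<close> a positive number. These
  guards are the only tests of values, and with them the nondeterministic \<open>Star\<close> can be
  forced to behave like a while loop.\<close>

primrec sem :: "prog \<Rightarrow> nat list \<Rightarrow> nat list \<Rightarrow> bool" where
  "sem Push = (\<lambda>s t. t = 0 # s)"
| "sem Pop = (\<lambda>s t. s = 0 # t)"
| "sem Inc = (\<lambda>s t. \<exists>x u. s = x # u \<and> t = Suc x # u)"
| "sem Dec = (\<lambda>s t. \<exists>x u. s = Suc x # u \<and> t = x # u)"
| "sem (Dip p) = (\<lambda>s t. \<exists>x u v. s = x # u \<and> t = x # v \<and> sem p u v)"
| "sem (Seq p q) = (\<lambda>s t. \<exists>u. sem p s u \<and> sem q u t)"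
| "sem (Star p) = (sem p)\<^sup>*\<^sup>*"

lemma sem_loop:
  "sem (Seq (Star p) q) s t \<longleftrightarrow> sem q s t \<or> (\<exists>u. sem p s u \<and> sem (Seq (Star p) q) u t)"
proof
  assume "sem (Seq (Star p) q) s t"
  then obtain u where "(sem p)\<^sup>*\<^sup>* s u" "sem q u t"
    by auto
  then show "sem q s t \<or> (\<exists>u. sem p s u \<and> sem (Seq (Star p) q) u t)"
    by (cases rule: converse_rtranclpE) auto
qed (auto intro: converse_rtranclp_into_rtranclp)

text \<open>The counter \<open>a\<close> is emptied into \<open>b\<close>: the body is blocked at
  \<open>a = 0\<close> and the exit at \<open>a > 0\<close>, so there is exactly one complete run.
  \<open>F\<close> says where the two counters sit in the stack.\<close>

lemma sem_transfer_loop: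
  assumes "\<And>a b t. sem p (F a b) t \<longleftrightarrow> (\<exists>a'. a = Suc a' \<and> t = F a' (Suc b))"
    and "\<And>a b t. sem q (F a b) t \<longleftrightarrow> a = 0 \<and> t = G b"
  shows "sem (Seq (Star p) q) (F a b) t \<longleftrightarrow> t = G (a + b)"
proof (induction a arbitrary: b)
  case 0
  then show ?case
    by (subst sem_loop) (simp add: assms)
next
  case (Suc a)
  then show ?case
    by (subst sem_loop) (simp add: assms del: sem.simps)
qed

section \<open>Rearranging stack entries\<close>

primrec dipn :: "nat \<Rightarrow> prog \<Rightarrow> prog" where
  "dipn 0 p = p"
| "dipn (Suc n) p = Dip (dipn n p)"

lemma sem_dipn:
  "length xs = n \<Longrightarrow> sem (dipn n p) (xs @ s) t \<longleftrightarrow> (\<exists>u. t = xs @ u \<and> sem p s u)"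
  by (induction xs arbitrary: n t) auto

definition discard :: prog where
  "discard = Seq (Star Dec) Pop"

lemma sem_discard [simp]: "sem discard (x # s) t \<longleftrightarrow> t = s"
  unfolding discard_def
  by (rule sem_transfer_loop[where F = "\<lambda>a b. a # s" and G = "\<lambda>_. s"]) auto

text \<open>\<open>Seq Push Pop\<close> plays the role of the empty program.\<close>

primrec discards :: "nat \<Rightarrow> prog" where
  "discards 0 = Seq Push Pop"
| "discards (Suc n) = Seq discard (discards n)"

lemma sem_discards [simp]: "length xs = n \<Longrightarrow> sem (discards n) (xs @ s) t \<longleftrightarrow> t = s"
  by (induction xs arbitrary: n) auto

definition move_down :: "nat \<Rightarrow> prog" where
  "move_down n = Seq (dipn (Suc n) Push) (Seq (Star (Seq Dec (dipn (Suc n) Inc))) Pop)"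

lemma sem_move_down:
  assumes "length xs = n"
  shows "sem (move_down n) (x # xs @ s) t \<longleftrightarrow> t = xs @ x # s"
proof -
  have "sem (Seq (Star (Seq Dec (dipn (Suc n) Inc))) Pop) (x # xs @ 0 # s) t \<longleftrightarrow>
      t = xs @ (x + 0) # s"
    by (rule sem_transfer_loop[where F = "\<lambda>a b. a # xs @ b # s" and G = "\<lambda>b. xs @ b # s"])
      (use assms in \<open>auto simp: sem_dipn\<close>)
  then show ?thesis
    using assms unfolding move_down_def by (simp add: sem_dipn del: sem.simps(7))
qed

definition move_up :: "nat \<Rightarrow> prog" where
  "move_up n =
     Seq Push (Seq (Star (Seq (dipn (Suc n) Dec) Inc)) (dipn (Suc n) Pop))"

lemma sem_move_up:
  assumes "length xs = n"
  shows "sem (move_up n) (xs @ x # s) t \<longleftrightarrow> t = x # xs @ s"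
proof -
  have "sem (Seq (Star (Seq (dipn (Suc n) Dec) Inc)) (dipn (Suc n) Pop)) (0 # xs @ x # s) t \<longleftrightarrow>
      t = (x + 0) # xs @ s"
    by (rule sem_transfer_loop[where F = "\<lambda>a b. b # xs @ a # s" and G = "\<lambda>b. b # xs @ s"])
      (use assms in \<open>auto simp: sem_dipn\<close>)
  then show ?thesis
    unfolding move_up_def by (simp del: sem.simps(7))
qed

text \<open>Reading an entry destroys it, so two fresh copies are filled simultaneously while the
  original is emptied.\<close>

definition duplicate :: prog where
  "duplicate =
     Seq Push (Seq Push (Seq (Star (Seq (Dip (Dip Dec)) (Seq Inc (Dip Inc)))) (Dip (Dip Pop))))"

lemma sem_duplicate: "sem duplicate (x # s) t \<longleftrightarrow> t = x # x # s"
proof -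
  have "sem (Seq (Star (Seq (Dip (Dip Dec)) (Seq Inc (Dip Inc)))) (Dip (Dip Pop))) (0 # 0 # x # s) t
      \<longleftrightarrow> t = (x + 0) # (x + 0) # s"
    by (rule sem_transfer_loop[where F = "\<lambda>a b. b # b # a # s" and G = "\<lambda>b. b # b # s"]) auto
  then show ?thesis
    unfolding duplicate_def by (simp del: sem.simps(7))
qed

definition copy_nth :: "nat \<Rightarrow> prog" where
  "copy_nth i = Seq (dipn i duplicate) (move_up i)"

lemma sem_copy_nth:
  assumes "i < length xs"
  shows "sem (copy_nth i) (xs @ s) t \<longleftrightarrow> t = xs ! i # xs @ s"
proof -
  have xs: "xs @ s = take i xs @ xs ! i # drop (Suc i) xs @ s" (is "_ = ?a @ ?x # ?s")
    using assms by (metis append.assoc append_Cons id_take_nth_drop)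
  have "length ?a = i"
    using assms by simp
  then show ?thesis
    by (simp add: xs copy_nth_def sem_dipn sem_duplicate sem_move_up)
qed

section \<open>Compiling recursive functions\<close>

text \<open>The arguments survive below the result, so that several functions can be evaluated on
  them in turn. The equivalence makes a complete run exist only where \<open>f\<close> has a
  value.\<close>

definition implements :: "prog \<Rightarrow> nat \<Rightarrow> recf \<Rightarrow> bool" where
  "implements p k f \<longleftrightarrow>
     (\<forall>xs s t. length xs = k \<longrightarrow>
        (sem p (xs @ s) t \<longleftrightarrow> (\<exists>y. rec_eval f xs y \<and> t = y # xs @ s)))"

lemma implementsD:
  "implements p k f \<Longrightarrow> length xs = k \<Longrightarrow>
    sem p (xs @ s) t \<longleftrightarrow> (\<exists>y. rec_eval f xs y \<and> t = y # xs @ s)"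
  by (simp add: implements_def)

text \<open>\<open>Dec\<close> is blocked on the zero just pushed. This covers arities at which
  \<open>f\<close> has no value at all, since a \<open>recf\<close> does not fix its arity.\<close>

lemma implements_undefined:
  assumes "\<And>xs y. length xs = k \<Longrightarrow> \<not> rec_eval f xs y"
  shows "implements (Seq Push Dec) k f"
  using assms by (auto simp: implements_def)

lemma implements_zero: "implements Push k RZero"
  by (auto simp: implements_def intro: rec_eval.zero elim: rec_evalE)

lemma implements_succ: "implements (Seq duplicate Inc) 1 RSucc"
  unfolding implements_def
proof (intro allI impI)
  fix xs s t :: "nat list"
  assume "length xs = 1"
  then obtain x where "xs = [x]"
    by (cases xs) auto
  then show "sem (Seq duplicate Inc) (xs @ s) t \<longleftrightarrow> (\<exists>y. rec_eval RSucc xs y \<and> t = y # xs @ s)"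
    by (auto simp: sem_duplicate intro: rec_eval.succ elim: rec_evalE)
qed

lemma implements_proj: "i < k \<Longrightarrow> implements (copy_nth i) k (RProj i)"
  by (auto simp: implements_def sem_copy_nth intro: rec_eval.proj elim: rec_evalE)

lemma implements_args:
  assumes "\<And>g. g \<in> set gs \<Longrightarrow> \<exists>p. implements p k g"
  shows "\<exists>p. \<forall>xs s t. length xs = k \<longrightarrow>
    (sem p (xs @ s) t \<longleftrightarrow> (\<exists>ys. list_all2 (\<lambda>g. rec_eval g xs) gs ys \<and> t = ys @ xs @ s))"
  using assms
proof (induction gs)
  case Nil
  show ?case
    by (rule exI[of _ "Seq Push Pop"]) auto
next
  case (Cons g gs)
  then obtain p q where p: "implements p k g"
    and q: "\<And>xs s t. length xs = k \<Longrightarrow>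
      sem q (xs @ s) t \<longleftrightarrow> (\<exists>ys. list_all2 (\<lambda>g. rec_eval g xs) gs ys \<and> t = ys @ xs @ s)"
    by (metis list.set_intros)
  show ?case
    \<comment> \<open>The remaining functions are evaluated beneath the first result, where the
      arguments are on top again; this also leaves the values in the order of
      \<open>gs\<close>.\<close>
    by (rule exI[of _ "Seq p (Dip q)"])
      (fastforce simp: implementsD[OF p] q list_all2_Cons1)
qed

lemma implements_comp:
  assumes p: "implements p (length gs) f"
    and "\<And>g. g \<in> set gs \<Longrightarrow> \<exists>p. implements p k g"
  shows "\<exists>p. implements p k (RComp f gs)"
proof -
  obtain q where q: "\<And>xs s t. length xs = k \<Longrightarrow>
      sem q (xs @ s) t \<longleftrightarrow> (\<exists>ys. list_all2 (\<lambda>g. rec_eval g xs) gs ys \<and> t = ys @ xs @ s)"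
    using implements_args[of gs k] assms(2) by blast
  have "implements (Seq q (Seq p (Dip (discards (length gs))))) k (RComp f gs)"
    unfolding implements_def
  proof (intro allI impI)
    fix xs s t :: "nat list"
    assume "length xs = k"
    then have "sem (Seq q (Seq p (Dip (discards (length gs))))) (xs @ s) t \<longleftrightarrow>
        (\<exists>ys. list_all2 (\<lambda>g. rec_eval g xs) gs ys \<and>
          (\<exists>z. rec_eval f ys z \<and> t = z # xs @ s))"
      by (fastforce simp: q implementsD[OF p] dest: list_all2_lengthD)
    then show "sem (Seq q (Seq p (Dip (discards (length gs))))) (xs @ s) t \<longleftrightarrow>
        (\<exists>y. rec_eval (RComp f gs) xs y \<and> t = y # xs @ s)"
      by (auto intro: rec_eval.comp elim!: rec_evalE(4))
  qed
  then show ?thesis ..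
qed

text \<open>The value at \<open>n\<close> is computed through all earlier stages. Hence a loop that
  gets stuck at some stage reflects undefinedness at \<open>n\<close>.\<close>

lemma rec_eval_prim_le:
  "rec_eval (RPrim f g) (n # xs) y \<Longrightarrow> j \<le> n \<Longrightarrow> \<exists>z. rec_eval (RPrim f g) (j # xs) z"
proof (induction n arbitrary: y)
  case (Suc n)
  then show ?case
    by (metis le_Suc_eq rec_evalE(6))
qed auto

lemma implements_prim:
  assumes p: "implements p k f" and q: "implements q (Suc (Suc k)) g"
  shows "\<exists>r. implements r (Suc k) (RPrim f g)"
proof -
  \<comment> \<open>Inside the loop the stack is \<open>i # y # xs @ m # s\<close>, where
    \<open>y\<close> is the value at \<open>i\<close>, \<open>m\<close> is the number of rounds left
    and \<open>i + m\<close> is the recursion argument \<open>n\<close>. At the end \<open>i\<close>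
    equals \<open>n\<close>, so swapping the top two entries restores the argument tuple below the
    result.\<close>
  define tidy where "tidy = Seq (Dip (Dip discard)) (Seq (move_down 1) Inc)"
  define step where "step = Seq q tidy"
  define body where "body = Seq (dipn (Suc (Suc k)) Dec) step"
  define fin where "fin = Seq (dipn (Suc (Suc k)) Pop) (move_down 1)"
  define r where "r = Seq (move_down k) (Seq p (Seq Push (Seq (Star body) fin)))"
  have "implements r (Suc k) (RPrim f g)"
    unfolding implements_def
  proof (intro allI impI)
    fix nxs s t :: "nat list"
    assume "length nxs = Suc k"
    then obtain n xs where nxs: "nxs = n # xs" and len: "length xs = k"
      by (metis length_Suc_conv)
    have move: "sem (move_down (Suc 0)) (x # y # s) t \<longleftrightarrow> t = y # x # s" for x y s t
      using sem_move_down[of "[y]" 1 x s t] by simp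
    have dip2: "sem (dipn (Suc (Suc k)) a) (i # y # xs @ s) t \<longleftrightarrow>
        (\<exists>u. t = i # y # xs @ u \<and> sem a s u)" for a i y s t
      using sem_dipn[of "i # y # xs" "Suc (Suc k)"] len by (simp del: dipn.simps)
    have sem_q: "sem q (i # y # xs @ s) t \<longleftrightarrow>
        (\<exists>z. rec_eval g (i # y # xs) z \<and> t = z # i # y # xs @ s)" for i y s t
      using implementsD[OF q, of "i # y # xs"] len by simp
    have tidy: "sem tidy (z # i # y # v) t \<longleftrightarrow> t = Suc i # z # v" for z i y v t
      unfolding tidy_def by (auto simp: move)
    have step: "sem step (i # y # xs @ s) t \<longleftrightarrow>
        (\<exists>z. rec_eval g (i # y # xs) z \<and> t = Suc i # z # xs @ s)" for i y s t
    proof -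
      have "sem step (i # y # xs @ s) t \<longleftrightarrow>
          (\<exists>z. rec_eval g (i # y # xs) z \<and> sem tidy (z # i # y # xs @ s) t)"
        unfolding step_def sem.simps sem_q by blast
      then show ?thesis
        by (simp add: tidy)
    qed
    have body: "sem body (i # y # xs @ m # s) t \<longleftrightarrow>
        (\<exists>m' z. m = Suc m' \<and> rec_eval g (i # y # xs) z \<and> t = Suc i # z # xs @ m' # s)"
      for i y m t
      unfolding body_def by (auto simp: dip2 step simp del: dipn.simps)
    have fin: "sem fin (i # y # xs @ m # s) t \<longleftrightarrow> m = 0 \<and> t = y # i # xs @ s" for i y m t
      unfolding fin_def by (auto simp: dip2 move simp del: dipn.simps)
    have loop: "sem (Seq (Star body) fin) (i # y # xs @ m # s) t \<longleftrightarrow>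
        (\<exists>z. rec_eval (RPrim f g) ((i + m) # xs) z \<and> t = z # (i + m) # xs @ s)"
      if "rec_eval (RPrim f g) (i # xs) y" for i y m
      using that
    proof (induction m arbitrary: i y)
      case 0
      then show ?case
        by (subst sem_loop) (auto simp: body fin dest: rec_eval_deterministic)
    next
      case (Suc m)
      \<comment> \<open>As \<open>y\<close> is the unique value at \<open>i\<close>, applying
        \<open>g\<close> to it is the same as evaluating the recursion at
        \<open>Suc i\<close>.\<close>
      have step: "rec_eval (RPrim f g) (Suc i # xs) z \<longleftrightarrow> rec_eval g (i # y # xs) z" for z
        using Suc.prems by (metis prim_Suc rec_evalE(6) rec_eval_deterministic)
      have "sem (Seq (Star body) fin) (i # y # xs @ Suc m # s) t \<longleftrightarrow>
          (\<exists>z. rec_eval g (i # y # xs) z \<and>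
            sem (Seq (Star body) fin) (Suc i # z # xs @ m # s) t)"
        by (subst sem_loop) (auto simp: body fin simp del: sem.simps)
      also have "\<dots> \<longleftrightarrow> (\<exists>z. rec_eval (RPrim f g) (Suc i # xs) z \<and>
          (\<exists>z. rec_eval (RPrim f g) ((Suc i + m) # xs) z \<and> t = z # (Suc i + m) # xs @ s))"
        using Suc.IH step by metis
      \<comment> \<open>Definedness at the last stage implies definedness at stage
        \<open>Suc i\<close>, so the outer existential is absorbed.\<close>
      also have "\<dots> \<longleftrightarrow>
          (\<exists>z. rec_eval (RPrim f g) ((Suc i + m) # xs) z \<and> t = z # (Suc i + m) # xs @ s)"
        using rec_eval_prim_le[of f g "Suc i + m" xs _ "Suc i"] by (metis le_add1)
      finally show ?case
        by simp
    qed
    have "sem r (nxs @ s) t \<longleftrightarrow>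
        (\<exists>y. rec_eval f xs y \<and> sem (Seq (Star body) fin) (0 # y # xs @ n # s) t)"
      using len by (auto simp: nxs r_def sem_move_down implementsD[OF p] simp del: sem.simps(7))
    also have "\<dots> \<longleftrightarrow> (\<exists>y. rec_eval (RPrim f g) (0 # xs) y \<and>
        (\<exists>z. rec_eval (RPrim f g) (n # xs) z \<and> t = z # n # xs @ s))"
      using loop[of 0 _ n] by (metis add_0 prim_0 rec_evalE(5))
    also have "\<dots> \<longleftrightarrow> (\<exists>z. rec_eval (RPrim f g) (n # xs) z \<and> t = z # n # xs @ s)"
      using rec_eval_prim_le[of f g n xs _ 0] by blast
    finally show "sem r (nxs @ s) t \<longleftrightarrow> (\<exists>y. rec_eval (RPrim f g) nxs y \<and> t = y # nxs @ s)"
      by (simp add: nxs)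
  qed
  then show ?thesis ..
qed

text \<open>The candidate \<open>i\<close> lies on top of the arguments. The body passes exactly on
  a positive value and the exit exactly on zero, so the loop can only be left at the least zero and
  gets stuck at an undefined value.\<close>

lemma implements_mu:
  assumes p: "implements p (Suc k) f"
  shows "\<exists>r. implements r k (RMu f)"
proof -
  define body where "body = Seq p (Seq Dec (Seq discard Inc))"
  define fin where "fin = Seq p Pop"
  have "implements (Seq Push (Seq (Star body) fin)) k (RMu f)"
    unfolding implements_def
  proof (intro allI impI)
    fix xs s t :: "nat list"
    assume len: "length xs = k"
    have sem_p: "sem p (i # xs @ s) t \<longleftrightarrow>
        (\<exists>z. rec_eval f (i # xs) z \<and> t = z # i # xs @ s)" for i t
      using implementsD[OF p, of "i # xs"] len by simp
    have body: "sem body (i # xs @ s) t \<longleftrightarrow>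
        (\<exists>z. rec_eval f (i # xs) (Suc z)) \<and> t = Suc i # xs @ s" for i t
      unfolding body_def by (auto simp: sem_p)
    have fin: "sem fin (i # xs @ s) t \<longleftrightarrow> rec_eval f (i # xs) 0 \<and> t = i # xs @ s" for i t
      unfolding fin_def by (auto simp: sem_p)
    have reach: "(sem body)\<^sup>*\<^sup>* (0 # xs @ s) u \<longleftrightarrow>
        (\<exists>n. (\<forall>m<n. \<exists>z. rec_eval f (m # xs) (Suc z)) \<and> u = n # xs @ s)" for u
    proof
      assume "(sem body)\<^sup>*\<^sup>* (0 # xs @ s) u"
      then show "\<exists>n. (\<forall>m<n. \<exists>z. rec_eval f (m # xs) (Suc z)) \<and> u = n # xs @ s"
        by induction (auto simp: body less_Suc_eq)
    next
      have "(sem body)\<^sup>*\<^sup>* (0 # xs @ s) (n # xs @ s)"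
        if "\<forall>m<n. \<exists>z. rec_eval f (m # xs) (Suc z)" for n
        using that by (induction n) (auto simp: body intro: rtranclp.rtrancl_into_rtrancl)
      then show "(sem body)\<^sup>*\<^sup>* (0 # xs @ s) u"
        if "\<exists>n. (\<forall>m<n. \<exists>z. rec_eval f (m # xs) (Suc z)) \<and> u = n # xs @ s"
        using that by blast
    qed
    have mu_iff: "rec_eval (RMu f) xs n \<longleftrightarrow>
        (\<forall>m<n. \<exists>z. rec_eval f (m # xs) (Suc z)) \<and> rec_eval f (n # xs) 0" for n
    proof
      assume "rec_eval (RMu f) xs n"
      then show "(\<forall>m<n. \<exists>z. rec_eval f (m # xs) (Suc z)) \<and> rec_eval f (n # xs) 0"
        by (rule rec_evalE(7)) simp
    qed (simp add: rec_eval.mu)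
    have "sem (Seq Push (Seq (Star body) fin)) (xs @ s) t \<longleftrightarrow>
        (\<exists>u. (sem body)\<^sup>*\<^sup>* (0 # xs @ s) u \<and> sem fin u t)"
      by simp
    also have "\<dots> \<longleftrightarrow>
        (\<exists>n. (\<forall>m<n. \<exists>z. rec_eval f (m # xs) (Suc z)) \<and> sem fin (n # xs @ s) t)"
      unfolding reach by blast
    also have "\<dots> \<longleftrightarrow>
        (\<exists>n. (\<forall>m<n. \<exists>z. rec_eval f (m # xs) (Suc z)) \<and> rec_eval f (n # xs) 0 \<and> t = n # xs @ s)"
      unfolding fin ..
    also have "\<dots> \<longleftrightarrow> (\<exists>n. rec_eval (RMu f) xs n \<and> t = n # xs @ s)"
      unfolding mu_iff by simp
    finally show "sem (Seq Push (Seq (Star body) fin)) (xs @ s) t \<longleftrightarrow>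
        (\<exists>n. rec_eval (RMu f) xs n \<and> t = n # xs @ s)" .
  qed
  then show ?thesis ..
qed

lemma ex_implements: "\<exists>p. implements p k f"
proof (induction f arbitrary: k)
  case RZero
  then show ?case
    using implements_zero by blast
next
  case RSucc
  have "\<not> rec_eval RSucc xs y" if "length xs \<noteq> 1" for xs y
    using that by (auto elim: rec_evalE)
  then show ?case
    using implements_succ implements_undefined[of k RSucc] by metis
next
  case (RProj i)
  have "\<not> rec_eval (RProj i) xs y" if "\<not> i < length xs" for xs y
    using that by (auto elim: rec_evalE)
  then show ?case
    using implements_proj implements_undefined[of k "RProj i"] by metis
next
  case (RComp f gs)
  then show ?case
    using implements_comp by metis
next
  case (RPrim f g)
  show ?case
  proof (cases k)
    case 0
    have "\<not> rec_eval (RPrim f g) [] y" for y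
      by (auto elim: rec_eval.cases)
    then show ?thesis
      using implements_undefined[of k "RPrim f g"] 0 by auto
  next
    case (Suc k')
    then show ?thesis
      using RPrim implements_prim by metis
  qed
next
  case (RMu f)
  then show ?case
    using implements_mu by metis
qed

text \<open>Throwing away result and arguments turns definedness into reaching one fixed stack, the
  empty one.\<close>

lemma ex_halting_program:
  "\<exists>p. \<forall>xs. length xs = k \<longrightarrow> (sem p xs [] \<longleftrightarrow> (\<exists>y. rec_eval f xs y))"
proof -
  obtain p where p: "implements p k f"
    using ex_implements by blast
  have "sem (Seq p (discards (Suc k))) xs [] \<longleftrightarrow> (\<exists>y. rec_eval f xs y)" if "length xs = k" for xs
    using that implementsD[OF p, of xs "[]"] sem_discards[of "_ # xs" "Suc k" "[]"]
    by (auto simp del: discards.simps)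
  then show ?thesis
    by blast
qed

section \<open>String rewriting\<close>

inductive srs_step :: "('a list \<times> 'a list) set \<Rightarrow> 'a list \<Rightarrow> 'a list \<Rightarrow> bool" for R where
  "(l, r) \<in> R \<Longrightarrow> srs_step R (u @ l @ v) (u @ r @ v)"

lemma srs_step_context: "srs_step R w w' \<Longrightarrow> srs_step R (u @ w @ v) (u @ w' @ v)"
proof (induction rule: srs_step.induct)
  case (1 l r u' v')
  then show ?case
    using srs_step.intros[of l r R "u @ u'" "v' @ v"] by simp
qed

lemma srs_steps_context:
  "(srs_step R)\<^sup>*\<^sup>* w w' \<Longrightarrow> (srs_step R)\<^sup>*\<^sup>* (u @ w @ v) (u @ w' @ v)"
  by (induction rule: rtranclp_induct)
    (auto intro: rtranclp.rtrancl_into_rtrancl srs_step_context)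

lemma srs_step_rule:
  "(l, r) \<in> R \<Longrightarrow> srs_step R (l @ v) (r @ v)"
  using srs_step.intros[of l r R "[]" v] by simp

text \<open>
  Every program is a letter, which acts on the stack described by the word to its right. As
  \<^const>\<open>Push\<close> and \<^const>\<open>Inc\<close> build up a stack from the right, they also serve as data letters.
\<close>

primrec enc :: "nat list \<Rightarrow> prog list" where
  "enc [] = []"
| "enc (x # s) = replicate x Inc @ Push # enc s"

text \<open>
  The rules for \<^const>\<open>Dec\<close> look one letter further to the right, because \<^const>\<open>Inc\<close> is undefined
  on the empty stack: \<open>Dec Inc\<close> is not total, so replacing it by the empty word would be unsound.
\<close>

primrec prog_rules :: "prog \<Rightarrow> (prog list \<times> prog list) list" where
  "prog_rules Push = []"
| "prog_rules Pop = [([Pop, Push], [])]"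
| "prog_rules Inc = []"
| "prog_rules Dec = [([Dec, Inc, Inc], [Inc]), ([Dec, Inc, Push], [Push])]"
| "prog_rules (Dip p) =
     ([Dip p, Inc], [Inc, Dip p]) # ([Dip p, Push], [Push, p]) # prog_rules p"
| "prog_rules (Seq p q) = ([Seq p q], [q, p]) # prog_rules p @ prog_rules q"
| "prog_rules (Star p) = ([Star p], []) # ([Star p], [Star p, p]) # prog_rules p"

lemma prog_rules_lhs: "(l, r) \<in> set (prog_rules p) \<Longrightarrow> l \<noteq> []"
  by (induction p) auto

text \<open>The letter crosses the unary digits of the top entry. It then stands before the
  \<open>Push\<close> that closes this entry, and the other rule for \<open>Dip\<close> releases
  \<open>p\<close> behind it.\<close>

lemma srs_steps_dip:
  assumes "([Dip p, Inc], [Inc, Dip p]) \<in> R"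
  shows "(srs_step R)\<^sup>*\<^sup>* (Dip p # replicate x Inc @ w) (replicate x Inc @ Dip p # w)"
proof (induction x)
  case (Suc x)
  have "srs_step R (Dip p # Inc # replicate x Inc @ w) (Inc # Dip p # replicate x Inc @ w)"
    using srs_step_rule[OF assms] by simp
  moreover have "(srs_step R)\<^sup>*\<^sup>* (Inc # Dip p # replicate x Inc @ w) (Inc # replicate x Inc @ Dip p # w)"
    using srs_steps_context[OF Suc, of "[Inc]" "[]"] by simp
  ultimately show ?case
    by (simp add: converse_rtranclp_into_rtranclp)
qed simp

text \<open>\<open>Push\<close> and \<open>Inc\<close> take no step: put in front of
  \<open>enc s\<close>, they already spell the encoding of the new stack.\<close>

lemma srs_steps_sem:
  "sem p s t \<Longrightarrow> set (prog_rules p) \<subseteq> R \<Longrightarrow> (srs_step R)\<^sup>*\<^sup>* (p # enc s) (enc t)"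
proof (induction p arbitrary: s t)
  case Pop
  then show ?case
    using srs_step_rule[of "[Pop, Push]" "[]" R "enc t"] by auto
next
  case Dec
  then obtain x u where st: "s = Suc x # u" "t = x # u"
    by auto
  show ?case
  proof (cases x)
    case 0
    then show ?thesis
      using Dec st srs_step_rule[of "[Dec, Inc, Push]" "[Push]" R "enc u"] by auto
  next
    case (Suc y)
    then show ?thesis
      using Dec st srs_step_rule[of "[Dec, Inc, Inc]" "[Inc]" R "replicate y Inc @ Push # enc u"]
      by auto
  qed
next
  case (Dip p)
  then obtain x u v where st: "s = x # u" "t = x # v" "sem p u v"
    by auto
  have "(srs_step R)\<^sup>*\<^sup>* (Dip p # enc s) (replicate x Inc @ Dip p # Push # enc u)"
    using srs_steps_dip[of p R x] Dip.prems st by simp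
  also have "srs_step R \<dots> (replicate x Inc @ Push # p # enc u)"
    using Dip.prems srs_step.intros[of "[Dip p, Push]" "[Push, p]" R "replicate x Inc" "enc u"]
    by simp
  also have "(srs_step R)\<^sup>*\<^sup>* \<dots> (enc t)"
    using srs_steps_context[OF Dip.IH[OF st(3)], of "replicate x Inc @ [Push]" "[]"] Dip.prems st
    by simp
  finally show ?case .
next
  case (Seq p q)
  then obtain u where u: "sem p s u" "sem q u t"
    by auto
  \<comment> \<open>The letter nearest to the stack acts first, which is why the two programs appear
    in reversed order.\<close>
  have "srs_step R (Seq p q # enc s) (q # p # enc s)"
    using Seq.prems srs_step_rule[of "[Seq p q]" "[q, p]" R "enc s"] by simp
  also have "(srs_step R)\<^sup>*\<^sup>* \<dots> (q # enc u)"
    using srs_steps_context[OF Seq.IH(1)[OF u(1)], of "[q]" "[]"] Seq.prems by simp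
  also have "(srs_step R)\<^sup>*\<^sup>* \<dots> (enc t)"
    using Seq.IH(2)[OF u(2)] Seq.prems by simp
  finally show ?case .
next
  case (Star p)
  from Star.prems(1) have "(sem p)\<^sup>*\<^sup>* s t"
    by simp
  then show ?case
  proof (induction rule: converse_rtranclp_induct)
    case base
    then show ?case
      using Star.prems srs_step_rule[of "[Star p]" "[]" R "enc t"] by auto
  next
    case (step s u)
    have "srs_step R (Star p # enc s) (Star p # p # enc s)"
      using Star.prems srs_step_rule[of "[Star p]" "[Star p, p]" R "enc s"] by simp
    also have "(srs_step R)\<^sup>*\<^sup>* \<dots> (Star p # enc u)"
      using srs_steps_context[OF Star.IH[OF step(1)], of "[Star p]" "[]"] Star.prems by simp
    also note step.IH
    finally show ?case .
  qed
qed auto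

section \<open>Soundness of the rules for word denotations\<close>

primrec word_sem :: "prog list \<Rightarrow> nat list \<Rightarrow> nat list \<Rightarrow> bool" where
  "word_sem [] = (=)"
| "word_sem (p # w) = (\<lambda>s t. \<exists>u. word_sem w s u \<and> sem p u t)"

lemma word_sem_append: "word_sem (v @ w) s t \<longleftrightarrow> (\<exists>u. word_sem w s u \<and> word_sem v u t)"
  by (induction v arbitrary: t) auto

lemma word_sem_replicate_Inc:
  "word_sem (replicate n Inc) (x # s) t \<longleftrightarrow> t = (n + x) # s"
  by (induction n arbitrary: t) auto

lemma word_sem_enc: "word_sem (enc s) [] t \<longleftrightarrow> t = s"
  by (induction s arbitrary: t) (auto simp: word_sem_append word_sem_replicate_Inc)

text \<open>Only the two rules for \<open>Star\<close> really shrink the relation, each by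
  committing to stopping or continuing; the other rules preserve it.\<close>

lemma word_sem_rule:
  "(l, r) \<in> set (prog_rules p) \<Longrightarrow> word_sem r s t \<Longrightarrow> word_sem l s t"
  by (induction p arbitrary: s t)
    (auto intro: rtranclp.rtrancl_into_rtrancl converse_rtranclp_into_rtranclp)

text \<open>Inclusion of relations is compatible with any surrounding word, so arbitrary
  interleavings of the program letters are covered.\<close>

lemma word_sem_srs_steps:
  "(srs_step (set (prog_rules p)))\<^sup>*\<^sup>* w w' \<Longrightarrow> word_sem w' s t \<Longrightarrow> word_sem w s t"
proof (induction arbitrary: t rule: rtranclp_induct)
  case (step w' w'')
  from step.hyps(2) step.prems have "word_sem w' s t"
    by (cases rule: srs_step.cases) (auto simp: word_sem_append dest: word_sem_rule)
  then show ?case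
    by (rule step.IH)
qed

lemma srs_steps_iff_sem:
  "(srs_step (set (prog_rules p)))\<^sup>*\<^sup>* (p # enc s) [] \<longleftrightarrow> sem p s []"
proof
  assume "(srs_step (set (prog_rules p)))\<^sup>*\<^sup>* (p # enc s) []"
  \<comment> \<open>The empty word denotes the identity, which relates the empty stack to itself.
    Pulled back to the first word, this is a run in which \<open>enc s\<close> builds
    \<open>s\<close> and \<open>p\<close> then empties it.\<close>
  then have "word_sem (p # enc s) [] []"
    by (rule word_sem_srs_steps) simp
  then show "sem p s []"
    by (simp add: word_sem_enc)
next
  assume "sem p s []"
  then show "(srs_step (set (prog_rules p)))\<^sup>*\<^sup>* (p # enc s) []"
    using srs_steps_sem[of p s "[]"] by simp
qed

section \<open>Words as terms\<close>

text \<open>The \<open>Suc\<close> reserves the symbol \<open>0\<close> for the root of a word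
  term.\<close>

definition letter :: "prog \<Rightarrow> nat gterm" where
  "letter p = Fn (Suc (to_nat p)) []"

definition word_term :: "prog list \<Rightarrow> nat gterm" where
  "word_term w = Fn 0 (map letter w)"

lemma inj_letter: "inj letter"
  by (auto simp: letter_def inj_def)

lemma word_term_inject [simp]: "word_term v = word_term w \<longleftrightarrow> v = w"
  by (simp add: word_term_def inj_map_eq_map[OF inj_letter])

lemma plug_eq_Nil [simp]: "plug u h = [] \<longleftrightarrow> u = Hole [] [] \<and> h = []"
  by (cases u) auto

text \<open>Letters have no arguments, so a nonempty hedge cannot sit below one of them.\<close>

lemma plug_eq_map_letter:
  assumes "map letter w = plug u (map letter l)" "l \<noteq> []"
  obtains v v' where "u = Hole (map letter v) (map letter v')" "w = v @ l @ v'"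
proof (cases u)
  case (Hole h h')
  with assms(1) obtain v l' v' where "w = v @ l' @ v'" "h = map letter v"
    "map letter l = map letter l'" "h' = map letter v'"
    by (auto simp: map_eq_append_conv append_eq_map_conv)
  then show ?thesis
    using that Hole inj_letter by (metis inj_map_eq_map)
next
  case (Under h a u' h')
  then have "Fn a (plug u' (map letter l)) \<in> set (map letter w)"
    using assms(1) by simp
  then show ?thesis
    using assms(2) by (auto simp: letter_def)
qed

text \<open>The root symbol is not a letter, so a match lies strictly below the root. An empty
  \<open>l\<close> would match anywhere, even beside the root or below a letter.\<close>

lemma plug_eq_word_term:
  assumes "[word_term w] = plug u (map letter l)" "l \<noteq> []"
  obtains v v' where "u = Under [] 0 (Hole (map letter v) (map letter v')) []" "w = v @ l @ v'"
proof (cases u)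
  case (Hole h h')
  with assms have "word_term w \<in> set (map letter l)"
    by (cases l; cases h) auto
  then show ?thesis
    by (auto simp: word_term_def letter_def)
next
  case (Under h a u' h')
  with assms(1) have "u = Under [] 0 u' []" and w: "map letter w = plug u' (map letter l)"
    by (auto simp: word_term_def Cons_eq_append_conv)
  then show ?thesis
    using that by (metis plug_eq_map_letter assms(2))
qed

section \<open>An automaton for the constraint satisfied by all ground terms\<close>

definition universal_ha :: "nat list \<Rightarrow> ha" where
  "universal_ha \<Sigma> =
     \<lparr>ha_alphabet = \<Sigma>, ha_states = [0], ha_final = [0],
      ha_trans =
        map (\<lambda>a. (a, \<lparr>nfa_initial = [0], nfa_final = [0], nfa_trans = [(0, 0, 0)]\<rparr>, 0)) \<Sigma>\<rparr>"

lemma replicate_in_nfa_lang: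
  "replicate n 0 \<in> nfa_lang \<lparr>nfa_initial = [0], nfa_final = [0], nfa_trans = [(0, 0, 0)]\<rparr>"
proof -
  have "nfa_run \<lparr>nfa_initial = [0], nfa_final = [0], nfa_trans = [(0, 0, 0)]\<rparr> 0 (replicate n 0) 0"
    by (induction n) (auto intro: nfa_run.intros)
  then show ?thesis
    by (simp add: nfa_lang_def)
qed

text \<open>Nesting of contexts lets a run on a subhedge be replayed inside a larger hedge.\<close>

primrec context_comp :: "'a hcontext \<Rightarrow> 'a hcontext \<Rightarrow> 'a hcontext" where
  "context_comp (Hole h h') u =
     (case u of Hole k k' \<Rightarrow> Hole (h @ k) (k' @ h') | Under k a v k' \<Rightarrow> Under (h @ k) a v (k' @ h'))"
| "context_comp (Under h a v h') u = Under h a (context_comp v u) h'"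

lemma plug_context_comp: "plug (context_comp v u) h = plug v (plug u h)"
  by (induction v) (auto split: hcontext.split)

lemma ha_steps_context:
  "(ha_step A)\<^sup>*\<^sup>* h h' \<Longrightarrow> (ha_step A)\<^sup>*\<^sup>* (plug u h) (plug u h')"
proof (induction rule: rtranclp_induct)
  case (step h' h'')
  from step.hyps(2) have "ha_step A (plug u h') (plug u h'')"
    unfolding ha_step_def by (metis plug_context_comp)
  with step.IH show ?case
    by simp
qed simp

lemma universal_ha_steps:
  "symbols t \<subseteq> set \<Sigma> \<Longrightarrow> (ha_step (universal_ha \<Sigma>))\<^sup>*\<^sup>* [map_gterm Inl t] [state_term 0]"
proof (induction t)
  case (Fn a ts)
  \<comment> \<open>Arguments are reduced from left to right. Stating this for every
    \<open>us\<close> over the elements of \<open>ts\<close> keeps the outer induction hypothesis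
    applicable to all its members.\<close>
  have args: "(ha_step (universal_ha \<Sigma>))\<^sup>*\<^sup>* (map (map_gterm Inl) us)
      (map state_term (replicate (length us) 0))" if "set us \<subseteq> set ts" for us
    using that
  proof (induction us)
    case (Cons t us)
    then have "(ha_step (universal_ha \<Sigma>))\<^sup>*\<^sup>* [map_gterm Inl t] [state_term 0]"
      using Fn by auto
    then have "(ha_step (universal_ha \<Sigma>))\<^sup>*\<^sup>* (map (map_gterm Inl) (t # us))
        (state_term 0 # map (map_gterm Inl) us)"
      using ha_steps_context[of _ _ _ "Hole [] (map (map_gterm Inl) us)"] by fastforce
    also have "(ha_step (universal_ha \<Sigma>))\<^sup>*\<^sup>* \<dots>
        (state_term 0 # map state_term (replicate (length us) 0))"
      using ha_steps_context[of _ _ _ "Hole [state_term 0] []"] Cons by fastforce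
    finally show ?case
      by simp
  qed simp
  have "(ha_step (universal_ha \<Sigma>))\<^sup>*\<^sup>* [map_gterm Inl (Fn a ts)]
      [Fn (Inl a) (map state_term (replicate (length ts) 0))]"
    using ha_steps_context[OF args[OF subset_refl], of "Under [] (Inl a) (Hole [] []) []"] by simp
  also have "ha_step (universal_ha \<Sigma>) \<dots> [state_term 0]"
  proof -
    have "\<exists>N. (a, N, 0) \<in> set (ha_trans (universal_ha \<Sigma>)) \<and> replicate (length ts) 0 \<in> nfa_lang N"
      using Fn.prems replicate_in_nfa_lang by (auto simp: universal_ha_def)
    moreover have "plug (Hole [] []) h = h" for h :: "(nat + nat) hedge"
      by simp
    ultimately show ?thesis
      unfolding ha_step_def by metis
  qed
  finally show ?case .
qed

lemma universal_ha_lang: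
  "[t] \<in> ha_lang (universal_ha \<Sigma>) \<longleftrightarrow> symbols t \<subseteq> set \<Sigma>"
  using universal_ha_steps[of t \<Sigma>]
  by (auto simp: ha_lang_def ground_hedges_def ground_terms_def universal_ha_def)

text \<open>This set contains the source word for every input and is closed under the rules. It does
  not mention the input, so in \<open>prog_instance\<close> only the source term depends on
  \<open>s\<close>; the diagonalization relies on this.\<close>

definition prog_letters :: "prog \<Rightarrow> prog list" where
  "prog_letters p = p # Inc # Push # concat (map (\<lambda>(l, r). l @ r) (prog_rules p))"

definition prog_alphabet :: "prog \<Rightarrow> nat list" where
  "prog_alphabet p = 0 # map (Suc \<circ> to_nat) (prog_letters p)"

definition prog_instance :: "prog \<Rightarrow> nat list \<Rightarrow> reach_instance" where
  "prog_instance p s =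
     \<lparr>constraint = universal_ha (prog_alphabet p),
      rules = map (\<lambda>(l, r). (map letter l, map letter r)) (prog_rules p),
      source = word_term (p # enc s),
      target = word_term []\<rparr>"

lemma symbols_letter: "symbols (letter q) \<subseteq> set (prog_alphabet p) \<longleftrightarrow> q \<in> set (prog_letters p)"
  by (auto simp: letter_def prog_alphabet_def)

lemma symbols_word_term:
  "symbols (word_term w) \<subseteq> set (prog_alphabet p) \<longleftrightarrow> set w \<subseteq> set (prog_letters p)"
proof -
  have "symbols (word_term w) \<subseteq> set (prog_alphabet p) \<longleftrightarrow>
      (\<forall>q\<in>set w. symbols (letter q) \<subseteq> set (prog_alphabet p))"
    by (auto simp: word_term_def prog_alphabet_def)
  then show ?thesis
    by (auto simp: symbols_letter)
qed

lemma set_enc: "set (enc s) \<subseteq> {Inc, Push}"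
  by (induction s) auto

lemma set_source: "set (p # enc s) \<subseteq> set (prog_letters p)"
  using set_enc[of s] by (auto simp: prog_letters_def)

lemma prog_rules_letters:
  "(l, r) \<in> set (prog_rules p) \<Longrightarrow> set l \<subseteq> set (prog_letters p) \<and> set r \<subseteq> set (prog_letters p)"
  by (fastforce simp: prog_letters_def)

lemma wf_universal_ha: "wf_ha (universal_ha \<Sigma>)"
  by (auto simp: wf_ha_def universal_ha_def)

lemma wf_prog_instance: "wf_instance (prog_instance p s)"
proof -
  let ?\<Sigma> = "set (prog_alphabet p)"
  have hedge: "map letter w \<in> ground_hedges ?\<Sigma>" if "set w \<subseteq> set (prog_letters p)" for w
    using that symbols_letter by (fastforce simp: ground_hedges_def ground_terms_def)
  have word: "word_term w \<in> ground_terms ?\<Sigma>" if "set w \<subseteq> set (prog_letters p)" for w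
    using that symbols_word_term by (simp add: ground_terms_def)
  have "\<forall>(l, r)\<in>set (rules (prog_instance p s)). l \<in> ground_hedges ?\<Sigma> \<and> r \<in> ground_hedges ?\<Sigma>"
    using hedge prog_rules_letters[of _ _ p] by (auto simp: prog_instance_def)
  moreover have "source (prog_instance p s) \<in> ground_terms ?\<Sigma>"
    using word[OF set_source] by (simp add: prog_instance_def)
  moreover have "target (prog_instance p s) \<in> ground_terms ?\<Sigma>"
    using word[of "[]"] by (simp add: prog_instance_def)
  moreover have "constraint (prog_instance p s) = universal_ha (prog_alphabet p)"
    by (simp add: prog_instance_def)
  moreover have "ha_alphabet (universal_ha \<Sigma>) = \<Sigma>" for \<Sigma>
    by (simp add: universal_ha_def)
  ultimately show ?thesis
    by (simp add: wf_instance_def wf_universal_ha)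
qed

lemma pgtrs_step_word_term:
  "pgtrs_step (pgtrs_of (prog_instance p s)) (word_term w) t \<longleftrightarrow>
     set w \<subseteq> set (prog_letters p) \<and>
     (\<exists>w'. t = word_term w' \<and> srs_step (set (prog_rules p)) w w')" (is "?L \<longleftrightarrow> ?R")
proof
  assume ?L
  then obtain l r u where lr: "(l, r) \<in> set (prog_rules p)"
    and w: "set w \<subseteq> set (prog_letters p)"
    and u: "[word_term w] = plug u (map letter l)" "[t] = plug u (map letter r)"
    by (auto simp: pgtrs_step_def pgtrs_of_def prog_instance_def universal_ha_lang symbols_word_term)
  from u(1) prog_rules_lhs[OF lr] obtain v v'
    where "u = Under [] 0 (Hole (map letter v) (map letter v')) []" "w = v @ l @ v'"
    by (rule plug_eq_word_term)
  with u(2) have "t = word_term (v @ r @ v')" "srs_step (set (prog_rules p)) w (v @ r @ v')"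
    using lr by (auto simp: word_term_def intro: srs_step.intros)
  with w show ?R
    by blast
next
  assume ?R
  then have w: "set w \<subseteq> set (prog_letters p)"
    by simp
  from \<open>?R\<close> obtain l r v v' where lr: "(l, r) \<in> set (prog_rules p)" and "w = v @ l @ v'" "t = word_term (v @ r @ v')"
    by (auto elim!: srs_step.cases)
  then have u: "[word_term w] = plug (Under [] 0 (Hole (map letter v) (map letter v')) []) (map letter l)"
    "[t] = plug (Under [] 0 (Hole (map letter v) (map letter v')) []) (map letter r)"
    by (simp_all add: word_term_def)
  have "(ha_lang (universal_ha (prog_alphabet p)), map letter l, map letter r)
      \<in> pgtrs_of (prog_instance p s)"
    using lr by (force simp: pgtrs_of_def prog_instance_def)
  moreover have "[word_term w] \<in> ha_lang (universal_ha (prog_alphabet p))"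
    using w by (simp add: universal_ha_lang symbols_word_term)
  ultimately show ?L
    using u unfolding pgtrs_step_def by blast
qed

lemma srs_step_letters:
  assumes "srs_step (set (prog_rules p)) w w'" "set w \<subseteq> set (prog_letters p)"
  shows "set w' \<subseteq> set (prog_letters p)"
  using assms by cases (use prog_rules_letters in fastforce)

lemma reachable_prog_instance: "reachable (prog_instance p s) \<longleftrightarrow> sem p s []"
proof -
  let ?P = "pgtrs_step (pgtrs_of (prog_instance p s))"
  let ?S = "srs_step (set (prog_rules p))"
  have "?P\<^sup>*\<^sup>* (word_term w) t \<longleftrightarrow> (\<exists>w'. t = word_term w' \<and> ?S\<^sup>*\<^sup>* w w')"
    if w: "set w \<subseteq> set (prog_letters p)" for w t
  proof
    assume "?P\<^sup>*\<^sup>* (word_term w) t"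
    then show "\<exists>w'. t = word_term w' \<and> ?S\<^sup>*\<^sup>* w w'"
      by (induction rule: rtranclp_induct)
        (use w in \<open>auto simp: pgtrs_step_word_term intro: rtranclp.rtrancl_into_rtrancl\<close>)
  next
    \<comment> \<open>The letters are tracked as well, because the constraint is checked anew at
      every step.\<close>
    have "?P\<^sup>*\<^sup>* (word_term w) (word_term w') \<and> set w' \<subseteq> set (prog_letters p)"
      if "?S\<^sup>*\<^sup>* w w'" for w'
      using that
    proof (induction rule: rtranclp_induct)
      case (step w' w'')
      then have "?P (word_term w') (word_term w'')"
        by (auto simp: pgtrs_step_word_term)
      with step show ?case
        by (auto intro: rtranclp.rtrancl_into_rtrancl dest: srs_step_letters)
    qed (use w in simp)
    then show "?P\<^sup>*\<^sup>* (word_term w) t" if "\<exists>w'. t = word_term w' \<and> ?S\<^sup>*\<^sup>* w w'"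
      using that by blast
  qed
  from this[OF set_source] have "reachable (prog_instance p s) \<longleftrightarrow> ?S\<^sup>*\<^sup>* (p # enc s) []"
    by (auto simp: reachable_def prog_instance_def word_term_def[of "[]", symmetric])
  then show ?thesis
    by (simp add: srs_steps_iff_sem)
qed

section \<open>Diagonalization\<close>

definition total_rec :: "nat \<Rightarrow> (nat list \<Rightarrow> nat) \<Rightarrow> bool" where
  "total_rec k F \<longleftrightarrow> (\<exists>f. \<forall>xs. length xs = k \<longrightarrow> rec_eval f xs (F xs))"

lemma total_rec_Suc: "total_rec k F \<Longrightarrow> total_rec k (\<lambda>xs. Suc (F xs))"
  unfolding total_rec_def by (metis comp succ list_all2_Cons list_all2_Nil)

lemma total_rec_const: "total_rec k (\<lambda>_. n)"
proof (induction n)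
  case 0
  then show ?case
    unfolding total_rec_def by (metis zero)
qed (rule total_rec_Suc)

lemma total_rec_nth: "i < k \<Longrightarrow> total_rec k (\<lambda>xs. xs ! i)"
  unfolding total_rec_def by (metis proj)

lemma total_rec_rec_nat:
  assumes "total_rec 2 (\<lambda>xs. G (xs ! 0) (xs ! 1))" "total_rec k F" "total_rec k N"
  shows "total_rec k (\<lambda>xs. rec_nat (F xs) G (N xs))"
proof -
  obtain g where "\<forall>xs. length xs = 2 \<longrightarrow> rec_eval g xs (G (xs ! 0) (xs ! 1))"
    using assms(1) unfolding total_rec_def by blast
  from this[rule_format, of "[_, _]"] have g: "rec_eval g [i, y] (G i y)" for i y
    by simp
  obtain f n where f: "\<And>xs. length xs = k \<Longrightarrow> rec_eval f xs (F xs)"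
    and n: "\<And>xs. length xs = k \<Longrightarrow> rec_eval n xs (N xs)"
    using assms(2,3) unfolding total_rec_def by blast
  \<comment> \<open>The start value is passed to \<open>RPrim\<close> as its parameter
    \<open>z\<close>, which the step function has to ignore.\<close>
  let ?g = "RComp g [RProj 0, RProj 1]"
  have "rec_eval ?g [i, y, z] (G i y)" for i y z
    using proj[of 0 "[i, y, z]"] proj[of 1 "[i, y, z]"] by (intro comp[OF _ g]) simp
  then have "rec_eval (RPrim (RProj 0) ?g) [m, z] (rec_nat z G m)" for m z
    using proj[of 0 "[z]"] by (induction m) (auto intro: prim_0 prim_Suc)
  then have "rec_eval (RComp (RPrim (RProj 0) ?g) [n, f]) xs (rec_nat (F xs) G (N xs))"
    if "length xs = k" for xs
    using f[OF that] n[OF that] by (intro comp[where ys = "[N xs, F xs]"]) auto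
  then show ?thesis
    unfolding total_rec_def by blast
qed

lemma total_rec_add:
  assumes "total_rec k F" "total_rec k G"
  shows "total_rec k (\<lambda>xs. F xs + G xs)"
proof -
  have "rec_nat m (\<lambda>_. Suc) n = m + n" for m n
    by (induction n) auto
  moreover have "total_rec k (\<lambda>xs. rec_nat (F xs) (\<lambda>_. Suc) (G xs))"
    using assms by (intro total_rec_rec_nat total_rec_Suc total_rec_nth) auto
  ultimately show ?thesis
    by simp
qed

text \<open>For Cantor pairing: \<open>prod_encode (m, n) = triangle (m + n) + m\<close>.\<close>

lemma total_rec_triangle:
  assumes "total_rec k F"
  shows "total_rec k (\<lambda>xs. triangle (F xs))"
proof -
  have "rec_nat 0 (\<lambda>i y. y + Suc i) n = triangle n" for n
    by (induction n) auto
  moreover have "total_rec k (\<lambda>xs. rec_nat 0 (\<lambda>i y. y + Suc i) (F xs))"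
    using assms
    by (intro total_rec_rec_nat total_rec_add total_rec_Suc total_rec_nth total_rec_const) auto
  ultimately show ?thesis
    by simp
qed

lemma total_rec_prod_encode:
  "total_rec k F \<Longrightarrow> total_rec k G \<Longrightarrow> total_rec k (\<lambda>xs. prod_encode (F xs, G xs))"
  by (simp add: prod_encode_def total_rec_add total_rec_triangle)

lemma total_rec_list_encode_Cons:
  "total_rec k F \<Longrightarrow> total_rec k (\<lambda>xs. list_encode (G xs)) \<Longrightarrow>
    total_rec k (\<lambda>xs. list_encode (F xs # G xs))"
  by (simp add: total_rec_prod_encode total_rec_Suc)

text \<open>The input numbers occur in unary in the source word; a block whose length is itself an
  input is coded by iterated consing.\<close>

lemma total_rec_list_encode_replicate:
  assumes "total_rec k N" "total_rec k (\<lambda>xs. list_encode (G xs))"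
  shows "total_rec k (\<lambda>xs. list_encode (replicate (N xs) x @ G xs))"
proof -
  have "rec_nat (list_encode ys) (\<lambda>_ c. Suc (prod_encode (x, c))) n
      = list_encode (replicate n x @ ys)" for n ys
    by (induction n) auto
  moreover have
    "total_rec k (\<lambda>xs. rec_nat (list_encode (G xs)) (\<lambda>_ c. Suc (prod_encode (x, c))) (N xs))"
    using assms
    by (intro total_rec_rec_nat total_rec_Suc total_rec_prod_encode total_rec_nth total_rec_const)
      auto
  ultimately show ?thesis
    by simp
qed

definition letter_code :: "prog \<Rightarrow> nat" where
  "letter_code p = gterm_encode (letter p)"

text \<open>
  The code of an instance as a function of the codes \<open>a\<close> of its automaton, \<open>b\<close> of its rules and \<open>c\<close>
  of the first letter of its source word, if the rest of that word is the input \<open>[a, b, c]\<close>.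
  Having the three codes as separate inputs avoids decoding.
\<close>

definition self_code :: "nat \<Rightarrow> nat \<Rightarrow> nat \<Rightarrow> nat" where
  "self_code a b c = prod_encode (a, triple_encode
     (b, prod_encode (0, list_encode (c # map letter_code (enc [a, b, c]))),
      gterm_encode (word_term [])))"

lemma total_rec_self_code: "total_rec 3 (\<lambda>xs. self_code (xs ! 0) (xs ! 1) (xs ! 2))"
  unfolding self_code_def triple_encode_def enc.simps map_append map_replicate list.map prod.case
    append_Nil2
  by (intro total_rec_prod_encode total_rec_list_encode_Cons total_rec_list_encode_replicate
      total_rec_nth total_rec_const) simp_all

text \<open>Self-reference: \<open>a\<close>, \<open>b\<close>, \<open>c\<close> code parts of the
  instance that are fixed by \<open>p\<close> alone, so they can be chosen first and then supplied
  as the input of \<open>p\<close>.\<close>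

lemma instance_encode_prog_instance:
  assumes "a = ha_encode (universal_ha (prog_alphabet p))"
    and "b = list_encode (map (\<lambda>(l, r). prod_encode (hedge_encode l, hedge_encode r))
      (map (\<lambda>(l, r). (map letter l, map letter r)) (prog_rules p)))"
    and "c = letter_code p"
  shows "instance_encode (prog_instance p [a, b, c]) = self_code a b c"
  by (simp add: instance_encode_def prog_instance_def self_code_def word_term_def letter_code_def
      assms o_def)

text \<open>By determinism \<open>ys\<close> are the only argument values, so undefinedness of
  \<open>f\<close> at \<open>ys\<close> carries over to the composition as well.\<close>

lemma rec_eval_comp_iff:
  assumes "list_all2 (\<lambda>g. rec_eval g xs) gs ys"
  shows "rec_eval (RComp f gs) xs z \<longleftrightarrow> rec_eval f ys z"
proof
  assume "rec_eval (RComp f gs) xs z"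
  then obtain zs where "list_all2 (\<lambda>g. rec_eval g xs) gs zs" "rec_eval f zs z"
    by (rule rec_evalE(4))
  moreover from this(1) assms have "zs = ys"
    by (auto simp: list_all2_conv_all_nth intro!: nth_equalityI rec_eval_deterministic)
  ultimately show "rec_eval f ys z"
    by simp
qed (use assms in \<open>rule comp\<close>)

theorem theorem4:
  "\<not> decidable_on instance_encode {I. wf_instance I} reachable"
proof
  assume "decidable_on instance_encode {I. wf_instance I} reachable"
  then obtain f where f: "\<And>I. wf_instance I \<Longrightarrow>
      rec_eval f [instance_encode I] (if reachable I then 1 else 0)"
    by (auto simp: decidable_on_def)
  obtain g where "\<forall>xs. length xs = 3 \<longrightarrow> rec_eval g xs (self_code (xs ! 0) (xs ! 1) (xs ! 2))"
    using total_rec_self_code unfolding total_rec_def by blast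
  from this[rule_format, of "[_, _, _]"] have g: "rec_eval g [a, b, c] (self_code a b c)" for a b c
    by simp
  \<comment> \<open>The first argument is a dummy search variable ignored by \<open>h\<close>;
    minimization over it halts exactly if \<open>f\<close> answers \<open>0\<close>, that is,
    "unreachable".\<close>
  define h where "h = RComp f [RComp g [RProj 1, RProj 2, RProj 3]]"
  have h: "rec_eval h [n, a, b, c] y \<longleftrightarrow> rec_eval f [self_code a b c] y" for n a b c y
  proof -
    let ?xs = "[n, a, b, c]"
    have "rec_eval (RComp g [RProj 1, RProj 2, RProj 3]) ?xs (self_code a b c)"
      using proj[of 1 ?xs] proj[of 2 ?xs] proj[of 3 ?xs] by (intro comp[OF _ g]) simp
    then show ?thesis
      unfolding h_def by (intro rec_eval_comp_iff) simp
  qed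
  have halts: "(\<exists>n. rec_eval (RMu h) [a, b, c] n) \<longleftrightarrow> rec_eval f [self_code a b c] 0" for a b c
  proof
    show "rec_eval f [self_code a b c] 0" if "\<exists>n. rec_eval (RMu h) [a, b, c] n"
      using that h by (auto elim: rec_evalE(7))
    show "\<exists>n. rec_eval (RMu h) [a, b, c] n" if "rec_eval f [self_code a b c] 0"
      using that h mu[of h 0 "[a, b, c]"] by auto
  qed
  obtain p where p: "\<And>xs. length xs = 3 \<Longrightarrow> sem p xs [] \<longleftrightarrow> (\<exists>n. rec_eval (RMu h) xs n)"
    using ex_halting_program by metis
  obtain a b c where code: "instance_encode (prog_instance p [a, b, c]) = self_code a b c"
    using instance_encode_prog_instance by blast
  let ?I = "prog_instance p [a, b, c]"
  \<comment> \<open>The target is reachable iff \<open>p\<close> halts on its own codes, hence iff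
    \<open>f\<close> answers \<open>0\<close> on this very instance, whereas a correct
    \<open>f\<close> answers \<open>1\<close> on reachable instances.\<close>
  have "reachable ?I \<longleftrightarrow> rec_eval f [self_code a b c] 0"
    using p[of "[a, b, c]"] halts by (simp add: reachable_prog_instance)
  moreover have "rec_eval f [self_code a b c] (if reachable ?I then 1 else 0)"
    using f[OF wf_prog_instance[of p "[a, b, c]"]] code by simp
  ultimately show False
    by (auto dest: rec_eval_deterministic split: if_splits)
qed

end
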